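(* Let the target process be $\xi_t=\xi_0+M_t+A_t$, $0\le t\le T$, with $\xi_0\in L^2(\mathbb P)$, where $M$ is a square-integrable càdlàg martingale with $M_0=0$ and $A$ is an adapted càdlàg finite-variation process with $A_0=0$, such that $$\mathbb E[\langle M\rangle_T]+\mathbb E[|A|_T^2]<\infty .$$ Then for every $0<h\le T$, $$\omega_\xi(h)\le 2h\,\mathbb E[\langle M\rangle_T]+2h\,\mathbb E[|A|_T^2].$$ In particular $[\xi]^2_{\rm tr}<\infty$, and therefore $v(\kappa)=O(\sqrt\kappa)$ as $\kappa\downarrow0$.
   Context: Fix $T>0$, a filtered probability space $(\Omega,\mathcal F,(\mathcal F_t)_{0\le t\le T},\mathbb P)$ satisfying the usual conditions, and $x\in\mathbb R$. $\langle M\rangle$ is the predictable quadratic variation of $M$, and $|A|_T$ is the total variation of $A$ on $[0,T]$. Let $\mathcal U$ be the set of progressively measurable processes $u=(u_t)_{0\le t\le T}$ with $\mathbb E\int_0^T u_t^2\,dt<\infty$, and for $u\in\mathcal U$ let $X^u_t=x+\int_0^t u_s\,ds$. For $\kappa\ge0$, $$J_\kappa(u)=\mathbb E\Big[\tfrac12\int_0^T(X^u_t-\xi_t)^2\,dt+\tfrac{\kappa}{2}\int_0^Tu_t^2\,dt\Big],\qquad v(\kappa)=\inf_{u\in\mathcal U}J_\kappa(u).$$ Further, $\omega_\xi(h)=\mathbb E\int_0^T|\xi_t-\xi_{(t-h)^+}|^2\,dt$ for $h>0$, where $(t-h)^+=\max\{t-h,0\}$, and $[\xi]^2_{\rm 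tr}=\sup_{h>0}\omega_\xi(h)/h$.
   Formalization: The initial value ξ_0 is additionally assumed F_0-measurable; without this v(κ)=O(√κ) fails, e.g. for M=A=0 and nonconstant ξ_0 independent of F_T, while the bounds on ω_ξ do not involve ξ_0. *)

theory Defs
  imports "HOL-Probability.Probability" "HOL-Library.Landau_Symbols"
begin

text \<open>Processes are functions \<open>X t \<omega>\<close> of a real time and a sample point. Only times in \<open>{0..T}\<close>
  matter: the values of a process or of the filtration \<open>F\<close> outside \<open>{0..T}\<close> are irrelevant, which
  is why \<^locale>\<open>filtration\<close> (a filtration indexed by a whole type) is not used.\<close>

locale usual_filtered_prob_space = prob_space P + complete_measure P
  for P :: "'a measure" and F :: "real \<Rightarrow> 'a measure" and T :: real +
  assumes T_pos: "0 < T"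
    and subalgebra_F: "\<And>t. t \<in> {0..T} \<Longrightarrow> subalgebra P (F t)"
    and F_mono: "\<And>s t. 0 \<le> s \<Longrightarrow> s \<le> t \<Longrightarrow> t \<le> T \<Longrightarrow> sets (F s) \<subseteq> sets (F t)"
    and null_sets_F: "null_sets P \<subseteq> sets (F 0)"
    and right_continuous_F: "\<And>t. t \<in> {0..<T} \<Longrightarrow> sets (F t) = (\<Inter>s\<in>{t<..T}. sets (F s))"

definition adapted_process :: "(real \<Rightarrow> 'a measure) \<Rightarrow> real \<Rightarrow> (real \<Rightarrow> 'a \<Rightarrow> real) \<Rightarrow> bool" where
  "adapted_process F T X \<longleftrightarrow> (\<forall>t\<in>{0..T}. X t \<in> borel_measurable (F t))"

definition progressively_measurable ::
    "(real \<Rightarrow> 'a measure) \<Rightarrow> real \<Rightarrow> (real \<Rightarrow> 'a \<Rightarrow> real) \<Rightarrow> bool" where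
  "progressively_measurable F T X \<longleftrightarrow>
    (\<forall>t\<in>{0..T}. (\<lambda>(s, \<omega>). X s \<omega>) \<in> borel_measurable (restrict_space borel {0..t} \<Otimes>\<^sub>M F t))"

text \<open>The predictable \<open>\<sigma>\<close>-algebra on \<open>[0,T] \<times> \<Omega>\<close>.\<close>

definition predictable_sigma :: "'a measure \<Rightarrow> (real \<Rightarrow> 'a measure) \<Rightarrow> real \<Rightarrow> (real \<times> 'a) measure" where
  "predictable_sigma P F T = sigma ({0..T} \<times> space P)
    ({{0} \<times> B | B. B \<in> sets (F 0)} \<union>
     {{s<..t} \<times> B | s t B. 0 \<le> s \<and> s < t \<and> t \<le> T \<and> B \<in> sets (F s)})"

definition predictable_process ::
    "'a measure \<Rightarrow> (real \<Rightarrow> 'a measure) \<Rightarrow> real \<Rightarrow> (real \<Rightarrow> 'a \<Rightarrow> real) \<Rightarrow> bool" where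
  "predictable_process P F T X \<longleftrightarrow> (\<lambda>(t, \<omega>). X t \<omega>) \<in> borel_measurable (predictable_sigma P F T)"

definition cadlag_on :: "real \<Rightarrow> (real \<Rightarrow> real) \<Rightarrow> bool" where
  "cadlag_on T f \<longleftrightarrow> (\<forall>t\<in>{0..<T}. continuous (at_right t) f) \<and>
    (\<forall>t\<in>{0<..T}. \<exists>l. (f \<longlongrightarrow> l) (at_left t))"

definition cadlag_process :: "'a measure \<Rightarrow> real \<Rightarrow> (real \<Rightarrow> 'a \<Rightarrow> real) \<Rightarrow> bool" where
  "cadlag_process P T X \<longleftrightarrow> (\<forall>\<omega>\<in>space P. cadlag_on T (\<lambda>t. X t \<omega>))"

definition martingale ::
    "'a measure \<Rightarrow> (real \<Rightarrow> 'a measure) \<Rightarrow> real \<Rightarrow> (real \<Rightarrow> 'a \<Rightarrow> real) \<Rightarrow> bool" where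
  "martingale P F T X \<longleftrightarrow> adapted_process F T X \<and> (\<forall>t\<in>{0..T}. integrable P (X t)) \<and>
    (\<forall>s t. 0 \<le> s \<longrightarrow> s \<le> t \<longrightarrow> t \<le> T \<longrightarrow> (AE \<omega> in P. real_cond_exp P (F s) (X t) \<omega> = X s \<omega>))"

definition square_integrable_martingale ::
    "'a measure \<Rightarrow> (real \<Rightarrow> 'a measure) \<Rightarrow> real \<Rightarrow> (real \<Rightarrow> 'a \<Rightarrow> real) \<Rightarrow> bool" where
  "square_integrable_martingale P F T X \<longleftrightarrow>
    martingale P F T X \<and> (\<forall>t\<in>{0..T}. integrable P (\<lambda>\<omega>. (X t \<omega>)\<^sup>2))"

text \<open>\<open>Q\<close> is (a version of) \<open>\<langle>M\<rangle>\<close>, the Doob--Meyer compensator of \<open>M\<^sup>2\<close>. It is a relation because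
  the process is only determined up to indistinguishability.\<close>

definition predictable_quadratic_variation ::
    "'a measure \<Rightarrow> (real \<Rightarrow> 'a measure) \<Rightarrow> real \<Rightarrow> (real \<Rightarrow> 'a \<Rightarrow> real) \<Rightarrow> (real \<Rightarrow> 'a \<Rightarrow> real) \<Rightarrow> bool" where
  "predictable_quadratic_variation P F T M Q \<longleftrightarrow>
    predictable_process P F T Q \<and>
    (AE \<omega> in P. Q 0 \<omega> = 0 \<and> mono_on {0..T} (\<lambda>t. Q t \<omega>) \<and> cadlag_on T (\<lambda>t. Q t \<omega>)) \<and>
    martingale P F T (\<lambda>t \<omega>. (M t \<omega>)\<^sup>2 - Q t \<omega>)"

text \<open>The total variation \<open>|f|\<^sub>T\<close> on \<open>[0,T]\<close>, as a supremum over partitions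
  \<open>0 \<le> p 0 \<le> \<dots> \<le> p n \<le> T\<close>; it is \<open>\<infinity>\<close> when \<open>f\<close> is not of finite variation.\<close>

definition total_variation :: "real \<Rightarrow> (real \<Rightarrow> real) \<Rightarrow> ennreal" where
  "total_variation T f =
    (SUP (n, p) \<in> {(n :: nat, p :: nat \<Rightarrow> real). mono_on {..n} p \<and> p ` {..n} \<subseteq> {0..T}}.
      \<Sum>i<n. ennreal \<bar>f (p (Suc i)) - f (p i)\<bar>)"

definition finite_variation_process :: "'a measure \<Rightarrow> real \<Rightarrow> (real \<Rightarrow> 'a \<Rightarrow> real) \<Rightarrow> bool" where
  "finite_variation_process P T X \<longleftrightarrow> (\<forall>\<omega>\<in>space P. total_variation T (\<lambda>t. X t \<omega>) < \<infinity>)"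

text \<open>All expectations and time integrals of nonnegative quantities below are
  \<^typ>\<open>ennreal\<close>-valued, so that finiteness is a genuine assertion.\<close>

definition admissible_controls ::
    "'a measure \<Rightarrow> (real \<Rightarrow> 'a measure) \<Rightarrow> real \<Rightarrow> (real \<Rightarrow> 'a \<Rightarrow> real) set" where
  "admissible_controls P F T = {u. progressively_measurable F T u \<and>
    (\<integral>\<^sup>+\<omega>. (\<integral>\<^sup>+t\<in>{0..T}. ennreal ((u t \<omega>)\<^sup>2) \<partial>lborel) \<partial>P) < \<infinity>}"

text \<open>For admissible \<open>u\<close> almost every path is integrable on \<open>[0,T]\<close>; on the exceptional null set
  the Bochner integral has the irrelevant value \<open>0\<close> whenever the path is not integrable.\<close>

definition controlled_state :: "real \<Rightarrow> (real \<Rightarrow> 'a \<Rightarrow> real) \<Rightarrow> real \<Rightarrow> 'a \<Rightarrow> real" where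
  "controlled_state x u t \<omega> = x + (LINT s:{0..t}|lborel. u s \<omega>)"

definition tracking_cost ::
    "'a measure \<Rightarrow> real \<Rightarrow> real \<Rightarrow> (real \<Rightarrow> 'a \<Rightarrow> real) \<Rightarrow> real \<Rightarrow> (real \<Rightarrow> 'a \<Rightarrow> real) \<Rightarrow> ennreal" where
  "tracking_cost P T x \<xi> \<kappa> u =
    (\<integral>\<^sup>+\<omega>. (ennreal (1 / 2) * (\<integral>\<^sup>+t\<in>{0..T}. ennreal ((controlled_state x u t \<omega> - \<xi> t \<omega>)\<^sup>2) \<partial>lborel)
         + ennreal (\<kappa> / 2) * (\<integral>\<^sup>+t\<in>{0..T}. ennreal ((u t \<omega>)\<^sup>2) \<partial>lborel)) \<partial>P)"

definition value_function ::
    "'a measure \<Rightarrow> (real \<Rightarrow> 'a measure) \<Rightarrow> real \<Rightarrow> real \<Rightarrow> (real \<Rightarrow> 'a \<Rightarrow> real) \<Rightarrow> real \<Rightarrow> ennreal" where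
  "value_function P F T x \<xi> \<kappa> = (INF u\<in>admissible_controls P F T. tracking_cost P T x \<xi> \<kappa> u)"

definition translation_modulus ::
    "'a measure \<Rightarrow> real \<Rightarrow> (real \<Rightarrow> 'a \<Rightarrow> real) \<Rightarrow> real \<Rightarrow> ennreal" where
  "translation_modulus P T \<xi> h =
    (\<integral>\<^sup>+\<omega>. (\<integral>\<^sup>+t\<in>{0..T}. ennreal (\<bar>\<xi> t \<omega> - \<xi> (max (t - h) 0) \<omega>\<bar>\<^sup>2) \<partial>lborel) \<partial>P)"

definition translation_seminorm_sq :: "'a measure \<Rightarrow> real \<Rightarrow> (real \<Rightarrow> 'a \<Rightarrow> real) \<Rightarrow> ennreal" where
  "translation_seminorm_sq P T \<xi> = (SUP h\<in>{0<..}. translation_modulus P T \<xi> h / ennreal h)"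

end

theory Submission
  imports Defs
begin

text \<open>If \<open>f\<close> is nondecreasing then \<open>f t - f ((t - h)\<^sup>+)\<close> telescopes over \<open>[0,T]\<close>, so its integral is at
  most \<open>h (f T - f 0)\<close>. Apply this to \<open>f t = E[M\<^sub>t\<^sup>2]\<close>, whose increments are \<open>E[(M\<^sub>t - M\<^sub>s)\<^sup>2]\<close> by
  orthogonality and whose final value is \<open>E[\<langle>M\<rangle>\<^sub>T]\<close>, and pathwise to the variation of \<open>A\<close> on \<open>[0,t]\<close>,
  where \<open>(A\<^sub>t - A\<^sub>s)\<^sup>2 \<le> |A|\<^sub>T (|A|\<^sub>t - |A|\<^sub>s)\<close>; the two parts combine through \<open>(a + b)\<^sup>2 \<le> 2a\<^sup>2 + 2b\<^sup>2\<close>.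

  For the value function, extend \<open>\<xi>\<close> by the constant \<open>x\<close> to negative times, call the result \<open>g\<close>, and
  use the control \<open>u\<^sub>t = (g\<^sub>t - g\<^sub>t\<^sub>-\<^sub>h) / h\<close>. Its state is the average of \<open>g\<close> over \<open>[t - h, t]\<close>, so by
  Jensen the tracking error is \<open>O(h)\<close>, and the energy is the translation modulus of \<open>g\<close> divided by
  \<open>h\<^sup>2\<close>, which is \<open>O(1/h)\<close>. The choice \<open>h = \<surd>\<kappa>\<close> balances the two.\<close>

section \<open>Deterministic estimates for single paths\<close>

text \<open>Substituting \<open>t - h\<close> turns the lagged integral into one over
  \<open>{0..T - h}\<close>. Everything cancels except the last stretch \<open>{T - h..T}\<close>,
  which has length \<open>h\<close> and on which \<open>f t - f 0\<close> is at most
  \<open>f T - f 0\<close>.\<close>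

lemma nn_integral_mono_translation_le:
  fixes f :: "real \<Rightarrow> real"
  assumes f: "mono_on {0..T} f" and h: "0 < h" "h \<le> T"
  shows "(\<integral>\<^sup>+t\<in>{0..T}. ennreal (f t - f (max (t - h) 0)) \<partial>lborel) \<le> ennreal h * ennreal (f T - f 0)"
proof -
  \<comment> \<open>Clamping makes \<open>g\<close> monotone on the whole line, hence Borel
    measurable. Subtracting \<open>f 0\<close> makes it nonnegative and zero at negative times, so
    that \<open>g (t - h)\<close> needs no positive part.\<close>
  define g where "g t = f (max 0 (min T t)) - f 0" for t
  have fm: "f s \<le> f t" if "0 \<le> s" "s \<le> t" "t \<le> T" for s t
    using f that by (auto simp: mono_on_def)
  have "mono g"
    using h by (auto simp: mono_def g_def intro!: fm)
  then have [measurable]: "g \<in> borel_measurable borel"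
    by (rule borel_measurable_mono)
  have g0: "0 \<le> g t" and gT: "g t \<le> f T - f 0" for t
    using h by (auto simp: g_def intro!: fm)
  define D where "D = (\<integral>\<^sup>+t\<in>{0..T}. ennreal (g t - g (t - h)) \<partial>lborel)"
  define I where "I = (\<integral>\<^sup>+t\<in>{0..T - h}. ennreal (g t) \<partial>lborel)"
  have D_eq: "(\<integral>\<^sup>+t\<in>{0..T}. ennreal (f t - f (max (t - h) 0)) \<partial>lborel) = D"
    unfolding D_def using h
    by (auto intro!: nn_integral_cong simp: g_def indicator_def max_def min_def)
  have "I = (\<integral>\<^sup>+t. ennreal (g (t - h)) * indicator {0..T - h} (t - h) \<partial>lborel)"
    using nn_integral_real_affine[of "\<lambda>t. ennreal (g t) * indicator {0..T - h} t" 1 "- h"]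
    by (simp add: I_def)
  also have "\<dots> \<le> (\<integral>\<^sup>+t\<in>{0..T}. ennreal (g (t - h)) \<partial>lborel)"
    using h by (intro nn_integral_mono) (auto simp: indicator_def)
  finally have "D + I \<le> D + (\<integral>\<^sup>+t\<in>{0..T}. ennreal (g (t - h)) \<partial>lborel)"
    by (rule add_left_mono)
  also have "\<dots> = (\<integral>\<^sup>+t\<in>{0..T}. ennreal (g t) \<partial>lborel)"
    unfolding D_def using monoD[OF \<open>mono g\<close>] h g0
    by (subst nn_integral_add[symmetric])
       (auto intro!: nn_integral_cong simp: indicator_def ennreal_plus[symmetric] simp del: ennreal_plus)
  also have "\<dots> \<le> (\<integral>\<^sup>+t. ennreal (g t) * indicator {0..T - h} t
      + ennreal (f T - f 0) * indicator {T - h..T} t \<partial>lborel)"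
    using gT by (intro nn_integral_mono) (auto simp: indicator_def intro: ennreal_leI)
  also have "\<dots> = I + ennreal (f T - f 0) * ennreal h"
    using h by (simp add: I_def nn_integral_add nn_integral_cmult)
  finally have "I + D \<le> I + ennreal (f T - f 0) * ennreal h"
    by (simp add: add.commute)
  \<comment> \<open>In \<open>ennreal\<close> the common summand \<open>I\<close> can be cancelled
    only because it is finite.\<close>
  moreover have "I < top"
  proof -
    have "I \<le> (\<integral>\<^sup>+t. ennreal (f T - f 0) * indicator {0..T - h} t \<partial>lborel)"
      unfolding I_def using gT by (intro nn_integral_mono) (auto simp: indicator_def intro: ennreal_leI)
    also have "\<dots> < top"
      using h by (simp add: nn_integral_cmult ennreal_mult_less_top)
    finally show ?thesis .
  qed
  ultimately show ?thesis
    unfolding D_eq by (auto simp: ennreal_add_left_cancel_le mult.commute)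
qed

text \<open>Any partition of \<open>{0..s}\<close> can be prolonged by the two points
  \<open>s\<close> and \<open>t\<close>. The step from its last point to \<open>s\<close> adds a
  nonnegative term, and the step from \<open>s\<close> to \<open>t\<close> adds the
  increment.\<close>

lemma total_variation_add_le:
  assumes st: "0 \<le> s" "s \<le> t"
  shows "total_variation s f + ennreal \<bar>f t - f s\<bar> \<le> total_variation t f"
proof -
  let ?J = "\<lambda>s. {(n :: nat, p :: nat \<Rightarrow> real). mono_on {..n} p \<and> p ` {..n} \<subseteq> {0..s}}"
  let ?S = "\<lambda>(n, p). \<Sum>i<n. ennreal \<bar>f (p (Suc i)) - f (p i)\<bar>"
  \<comment> \<open>A supremum commutes with adding a constant only over a nonempty index set, which
    the one-point partition provides.\<close>
  have J: "(0, \<lambda>_. 0) \<in> ?J s"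
    using st by (auto simp: mono_on_def)
  have "total_variation s f + ennreal \<bar>f t - f s\<bar> = (SUP np\<in>?J s. ?S np + ennreal \<bar>f t - f s\<bar>)"
    unfolding total_variation_def using J
    by (subst ennreal_SUP_add_left) (blast, simp_all add: case_prod_unfold)
  also have "\<dots> \<le> total_variation t f"
  proof (rule SUP_least)
    fix np assume "np \<in> ?J s"
    then obtain n p where np: "np = (n, p)" and p: "mono_on {..n} p" "p ` {..n} \<subseteq> {0..s}"
      by auto
    define q where "q i = (if i \<le> n then p i else if i = Suc n then s else t)" for i
    have pb: "0 \<le> p i" "p i \<le> s" if "i \<le> n" for i
      using p(2) that by auto
    have "(Suc (Suc n), q) \<in> ?J t"
    proof -
      have "mono_on {..Suc (Suc n)} q"
        using p(1) st order_trans[OF pb(2) st(2)] by (auto simp: mono_on_def q_def pb)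
      moreover have "q ` {..Suc (Suc n)} \<subseteq> {0..t}"
        using st order_trans[OF pb(2) st(2)] by (auto simp: q_def pb)
      ultimately show ?thesis by simp
    qed
    moreover have "?S (n, p) + ennreal \<bar>f t - f s\<bar> \<le> ?S (Suc (Suc n), q)"
    proof -
      have "?S (n, p) = (\<Sum>i<n. ennreal \<bar>f (q (Suc i)) - f (q i)\<bar>)"
        by (auto simp: q_def)
      moreover have "f t - f s = f (q (Suc (Suc n))) - f (q (Suc n))"
        by (auto simp: q_def)
      ultimately show ?thesis
        by (simp add: add_increasing2 add.assoc add_left_mono add_increasing)
    qed
    ultimately show "?S np + ennreal \<bar>f t - f s\<bar> \<le> total_variation t f"
      unfolding total_variation_def np by (rule SUP_upper2)
  qed
  finally show ?thesis .
qed

text \<open>One factor of the squared increment is bounded by the total variation, the other by the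
  increment of the variation function. The product is an increment of the nondecreasing function
  \<open>v T * v t\<close>, to which the telescoping bound applies.\<close>

lemma nn_integral_translation_le_total_variation:
  assumes fin: "total_variation T f < \<infinity>" and h: "0 < h" "h \<le> T"
  shows "(\<integral>\<^sup>+t\<in>{0..T}. ennreal ((f t - f (max (t - h) 0))\<^sup>2) \<partial>lborel)
    \<le> ennreal h * (total_variation T f)\<^sup>2"
proof -
  define v where "v t = enn2real (total_variation t f)" for t
  have le_T: "total_variation t f \<le> total_variation T f" if "0 \<le> t" "t \<le> T" for t
    using total_variation_add_le[OF that, of f] by (meson add_increasing2 order_trans zero_le order_refl le_iff_add)
  have ev: "ennreal (v t) = total_variation t f" if "0 \<le> t" "t \<le> T" for t
    using le_T[OF that] fin unfolding v_def by (intro ennreal_enn2real) auto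
  have v_nonneg: "0 \<le> v t" for t
    by (simp add: v_def)
  have v_diff: "v s + \<bar>f t - f s\<bar> \<le> v t" if "0 \<le> s" "s \<le> t" "t \<le> T" for s t
  proof -
    have "ennreal (v s + \<bar>f t - f s\<bar>) \<le> ennreal (v t)"
      using total_variation_add_le[of s t f] that by (simp add: ev v_nonneg)
    then show ?thesis by (subst (asm) ennreal_le_iff) (simp_all add: v_nonneg)
  qed
  have v_T: "v t \<le> v T" if "0 \<le> t" "t \<le> T" for t
    using v_diff[of t T] that by linarith
  have "mono_on {0..T} (\<lambda>t. v T * v t)"
    using v_nonneg v_diff by (intro mono_onI mult_left_mono) (smt (verit) atLeastAtMost_iff)+
  then have "(\<integral>\<^sup>+t\<in>{0..T}. ennreal (v T * v t - v T * v (max (t - h) 0)) \<partial>lborel)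
      \<le> ennreal h * ennreal (v T * v T - v T * v 0)"
    using h by (rule nn_integral_mono_translation_le)
  moreover have "(f t - f (max (t - h) 0))\<^sup>2 \<le> v T * v t - v T * v (max (t - h) 0)"
    if t: "0 \<le> t" "t \<le> T" for t
  proof -
    let ?d = "f t - f (max (t - h) 0)"
    have d: "\<bar>?d\<bar> \<le> v t - v (max (t - h) 0)"
      using v_diff[of "max (t - h) 0" t] t h by simp
    moreover have "\<bar>?d\<bar> \<le> v T"
      using d v_T[OF t] v_nonneg[of "max (t - h) 0"] by linarith
    ultimately have "\<bar>?d\<bar> * \<bar>?d\<bar> \<le> v T * (v t - v (max (t - h) 0))"
      using v_nonneg by (intro mult_mono) auto
    then show ?thesis by (simp add: power2_eq_square algebra_simps)
  qed
  then have "(\<integral>\<^sup>+t\<in>{0..T}. ennreal ((f t - f (max (t - h) 0))\<^sup>2) \<partial>lborel)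
     \<le> (\<integral>\<^sup>+t\<in>{0..T}. ennreal (v T * v t - v T * v (max (t - h) 0)) \<partial>lborel)"
    by (intro nn_integral_mono) (auto simp: indicator_def intro: ennreal_leI)
  moreover have "ennreal h * ennreal (v T * v T - v T * v 0) \<le> ennreal h * (ennreal (v T))\<^sup>2"
    using v_nonneg by (intro mult_left_mono) (auto simp: power2_eq_square ennreal_mult[symmetric] intro!: ennreal_leI)
  ultimately show ?thesis
    using h ev[of T] by simp
qed

text \<open>Cauchy-Schwarz against the indicator of \<open>{0..h}\<close> costs a factor
  \<open>h\<close>, which turns the prefactor \<open>1 / h\<^sup>2\<close> into
  \<open>1 / h\<close>.\<close>

lemma set_nn_integral_average_sq_le:
  fixes z :: "real \<Rightarrow> real"
  assumes z: "set_integrable lborel {0..h} z" and h: "0 < h"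
  shows "ennreal ((1 / h * (LINT r:{0..h}|lborel. z r))\<^sup>2)
    \<le> ennreal (1 / h) * (\<integral>\<^sup>+r\<in>{0..h}. ennreal ((z r)\<^sup>2) \<partial>lborel)"
proof -
  let ?z = "\<lambda>r. indicator {0..h} r * z r"
  have zi: "integrable lborel ?z"
    using z by (simp add: set_integrable_def)
  then have [measurable]: "?z \<in> borel_measurable lborel"
    by (rule borel_measurable_integrable)
  have "ennreal \<bar>LINT r:{0..h}|lborel. z r\<bar> \<le> (\<integral>\<^sup>+r. ennreal \<bar>?z r\<bar> \<partial>lborel)"
    using integral_norm_bound_ennreal[OF zi] by (simp add: set_lebesgue_integral_def)
  also have "\<dots> = (\<integral>\<^sup>+r. ennreal \<bar>?z r\<bar> * indicator {0..h} r \<partial>lborel)"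
    by (intro nn_integral_cong) (auto simp: indicator_def)
  finally have "(ennreal \<bar>LINT r:{0..h}|lborel. z r\<bar>)\<^sup>2
      \<le> (\<integral>\<^sup>+r. ennreal \<bar>?z r\<bar> * indicator {0..h} r \<partial>lborel)\<^sup>2"
    by (intro power_mono) auto
  also have "\<dots> \<le> (\<integral>\<^sup>+r. (ennreal \<bar>?z r\<bar>)\<^sup>2 \<partial>lborel) * (\<integral>\<^sup>+r. (indicator {0..h} r)\<^sup>2 \<partial>lborel)"
    by (rule Cauchy_Schwarz_nn_integral) auto
  also have "(\<integral>\<^sup>+r. (ennreal \<bar>?z r\<bar>)\<^sup>2 \<partial>lborel) = (\<integral>\<^sup>+r\<in>{0..h}. ennreal ((z r)\<^sup>2) \<partial>lborel)"
    by (intro nn_integral_cong) (auto simp: indicator_def ennreal_power)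
  also have "(\<integral>\<^sup>+r. (indicator {0..h} r)\<^sup>2 \<partial>lborel) = (\<integral>\<^sup>+r. indicator {0..h} r \<partial>lborel)"
    by (intro nn_integral_cong) (auto simp: indicator_def)
  also have "\<dots> = ennreal h"
    using h by simp
  finally have *: "ennreal ((LINT r:{0..h}|lborel. z r)\<^sup>2)
      \<le> (\<integral>\<^sup>+r\<in>{0..h}. ennreal ((z r)\<^sup>2) \<partial>lborel) * ennreal h"
    by (simp add: ennreal_power)
  have "ennreal ((1 / h * (LINT r:{0..h}|lborel. z r))\<^sup>2)
      = ennreal (1 / h\<^sup>2) * ennreal ((LINT r:{0..h}|lborel. z r)\<^sup>2)"
    by (simp add: power_divide ennreal_mult[symmetric])
  also have "\<dots> \<le> ennreal (1 / h\<^sup>2) * ((\<integral>\<^sup>+r\<in>{0..h}. ennreal ((z r)\<^sup>2) \<partial>lborel) * ennreal h)"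
    using * by (rule mult_left_mono) simp
  also have "\<dots> = (ennreal (1 / h\<^sup>2) * ennreal h) * (\<integral>\<^sup>+r\<in>{0..h}. ennreal ((z r)\<^sup>2) \<partial>lborel)"
    by (simp add: mult_ac)
  also have "ennreal (1 / h\<^sup>2) * ennreal h = ennreal (1 / h)"
    using h by (simp add: ennreal_mult[symmetric] power2_eq_square)
  finally show ?thesis .
qed

text \<open>The integral of the difference quotient is the integral of \<open>g\<close> over
  \<open>{t - h..t}\<close> minus that over \<open>{- h..0}\<close>, divided by \<open>h\<close>.
  The second part equals \<open>x\<close>, since \<open>g\<close> is \<open>x\<close> at negative
  times, and cancels the initial state.\<close>

lemma steklov_average_eq:
  fixes g :: "real \<Rightarrow> real"
  assumes g: "\<And>a b. set_integrable lborel {a..b} g" and x: "\<And>s. s < 0 \<Longrightarrow> g s = x"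
    and h: "0 < h" and t: "0 \<le> t"
  shows "set_integrable lborel {0..h} (\<lambda>r. g (t - r))"
    and "x + (LINT s:{0..t}|lborel. (g s - g (s - h)) / h) = 1 / h * (LINT r:{0..h}|lborel. g (t - r))"
proof -
  have refl: "set_integrable lborel {a..b} (\<lambda>r. g (c - r))" for a b c
  proof -
    have "integrable lborel (\<lambda>r. indicator {c - b..c - a} (c + (- 1) * r) * g (c + (- 1) * r))"
      using lborel_integrable_real_affine[of "\<lambda>r. indicator {c - b..c - a} r * g r" "- 1" c] g[of "c - b" "c - a"]
      by (simp add: set_integrable_def)
    also have "(\<lambda>r. indicator {c - b..c - a} (c + (- 1) * r) * g (c + (- 1) * r))
        = (\<lambda>r. indicator {a..b} r * g (c - r))"
      by (auto simp: indicator_def)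
    finally show ?thesis by (simp add: set_integrable_def)
  qed
  then show "set_integrable lborel {0..h} (\<lambda>r. g (t - r))" .
  have shift: "set_integrable lborel {0..t} (\<lambda>s. g (s - h))"
  proof -
    have "integrable lborel (\<lambda>r. indicator {- h..t - h} (- h + 1 * r) * g (- h + 1 * r))"
      using lborel_integrable_real_affine[of "\<lambda>r. indicator {- h..t - h} r * g r" 1 "- h"] g[of "- h" "t - h"]
      by (simp add: set_integrable_def)
    also have "(\<lambda>r. indicator {- h..t - h} (- h + 1 * r) * g (- h + 1 * r))
        = (\<lambda>r. indicator {0..t} r * g (r - h))"
      by (auto simp: indicator_def)
    finally show ?thesis by (simp add: set_integrable_def)
  qed
  \<comment> \<open>Shifting, reflecting and splitting intervals is carried out with the gauge
    integral, which agrees with the Lebesgue integral here.\<close>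
  have HK: "g integrable_on {a..b}" for a b
    using g by (rule set_borel_integral_eq_integral)
  have "(LINT s:{0..t}|lborel. (g s - g (s - h)) / h)
      = ((LINT s:{0..t}|lborel. g s) - (LINT s:{0..t}|lborel. g (s - h))) / h"
    using g[of 0 t] shift by (simp add: set_integral_divide_zero set_integral_diff)
  also have "(LINT s:{0..t}|lborel. g s) = integral {0..t} g"
    using g by (rule set_borel_integral_eq_integral)
  also have "(LINT s:{0..t}|lborel. g (s - h)) = integral {0..t} (\<lambda>s. g (s + (- h)))"
    using shift by (simp add: set_borel_integral_eq_integral)
  also have "\<dots> = integral {- h..t - h} g"
    using integral_shift_real_ivl[of "- h" "- h" "t - h" g] by simp
  finally have 1: "(LINT s:{0..t}|lborel. (g s - g (s - h)) / h)
      = (integral {0..t} g - integral {- h..t - h} g) / h" .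
  \<comment> \<open>Both sides are the integral over \<open>{- h..t}\<close>, split at
    \<open>0\<close> and at \<open>t - h\<close>; this is valid for \<open>t < h\<close> as well as
    for \<open>h \<le> t\<close>.\<close>
  have 2: "integral {- h..0} g + integral {0..t} g = integral {- h..t - h} g + integral {t - h..t} g"
    using Henstock_Kurzweil_Integration.integral_combine[of "- h" 0 t g]
      Henstock_Kurzweil_Integration.integral_combine[of "- h" "t - h" t g] h t HK by simp
  \<comment> \<open>The value \<open>g 0\<close> may differ from \<open>x\<close>, so the single
    point \<open>0\<close> is discarded.\<close>
  have "integral {- h..0} g = integral {- h..0} (\<lambda>_. x)"
    by (rule integral_spike[where S = "{0}"]) (auto simp: x)
  then have 3: "integral {- h..0} g = h * x"
    using h by simp
  have "(LINT r:{0..h}|lborel. g (t - r)) = integral {0..h} (\<lambda>r. g (t - r))"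
    using refl by (rule set_borel_integral_eq_integral)
  also have "\<dots> = integral {- h..- 0} (\<lambda>r. g (t + r))"
    using Henstock_Kurzweil_Integration.integral_reflect_real[of h 0 "\<lambda>r. g (t + r)"]
      Henstock_Kurzweil_Integration.integral_reflect_real[where a = 0 and b = h and f = "\<lambda>r. g (t - r)"] by simp
  also have "\<dots> = integral {t - h..t} g"
    using integral_shift_real_ivl[of "t - h" t t g] by (simp add: add.commute)
  finally have 4: "(LINT r:{0..h}|lborel. g (t - r)) = integral {t - h..t} g" .
  show "x + (LINT s:{0..t}|lborel. (g s - g (s - h)) / h) = 1 / h * (LINT r:{0..h}|lborel. g (t - r))"
    unfolding 1 4 using 2 3 h by (simp add: field_simps)
qed

text \<open>For nonmeasurable \<open>f\<close> the integrals are lower integrals; this covers \<open>f = |A|\<^sub>T\<^sup>2\<close>, a supremum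
  over uncountably many partitions.\<close>

lemma nn_integral_cmult_le:
  assumes c: "0 < c"
  shows "(\<integral>\<^sup>+x. ennreal c * f x \<partial>M) \<le> ennreal c * (\<integral>\<^sup>+x. f x \<partial>M)"
proof -
  have "integral\<^sup>S M g \<le> ennreal c * (\<integral>\<^sup>+x. f x \<partial>M)"
    if g: "simple_function M g" "g \<le> (\<lambda>x. ennreal c * f x)" for g
  proof -
    have [measurable]: "g \<in> borel_measurable M"
      using g(1) by (rule borel_measurable_simple_function)
    \<comment> \<open>Linearity is applied only to the simple function \<open>g\<close>: divided by
      \<open>c\<close> it lies below \<open>f\<close>, and monotonicity does the rest.\<close>
    have cc: "ennreal c * ennreal (1 / c) = 1"
      using c by (simp add: ennreal_mult[symmetric])
    have "integral\<^sup>S M g = (\<integral>\<^sup>+x. (ennreal c * ennreal (1 / c)) * g x \<partial>M)"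
      unfolding cc using g(1) by (simp add: nn_integral_eq_simple_integral)
    also have "\<dots> = ennreal c * (\<integral>\<^sup>+x. ennreal (1 / c) * g x \<partial>M)"
      by (simp add: nn_integral_cmult mult.assoc)
    also have "\<dots> \<le> ennreal c * (\<integral>\<^sup>+x. f x \<partial>M)"
    proof (intro mult_left_mono nn_integral_mono)
      fix x
      have "ennreal (1 / c) * g x \<le> ennreal (1 / c) * (ennreal c * f x)"
        using g(2) by (intro mult_left_mono) (auto simp: le_fun_def)
      also have "\<dots> = (ennreal c * ennreal (1 / c)) * f x"
        by (simp only: mult_ac)
      finally show "ennreal (1 / c) * g x \<le> f x"
        by (simp add: cc)
    qed simp
    finally show ?thesis .
  qed
  then show ?thesis
    by (subst nn_integral_def) (auto intro!: SUP_least)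
qed

lemma ennreal_sq_add_le: "ennreal ((a + b)\<^sup>2) \<le> 2 * ennreal (a\<^sup>2) + 2 * ennreal (b\<^sup>2)"
proof -
  have "(a + b)\<^sup>2 \<le> 2 * a\<^sup>2 + 2 * b\<^sup>2"
    using sum_squares_bound[of a b] by (simp add: power2_sum)
  then have "ennreal ((a + b)\<^sup>2) \<le> ennreal (2 * a\<^sup>2 + 2 * b\<^sup>2)"
    by (rule ennreal_leI)
  then show ?thesis
    by (simp add: ennreal_mult)
qed

section \<open>Measurability of processes\<close>

context usual_filtered_prob_space
begin

lemma measurable_F_mono:
  assumes "f \<in> measurable (F s) N" "0 \<le> s" "s \<le> t" "t \<le> T"
  shows "f \<in> measurable (F t) N"
proof (rule measurable_from_subalg[OF _ assms(1)])
  show "subalgebra (F t) (F s)"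
    using F_mono[of s t] subalgebra_F[of s] subalgebra_F[of t] assms(2-)
    by (auto simp: subalgebra_def)
qed

lemma measurable_F:
  assumes "f \<in> measurable (F t) N" "0 \<le> t" "t \<le> T"
  shows "f \<in> measurable P N"
  using measurable_from_subalg[OF subalgebra_F assms(1)] assms(2,3) by simp

text \<open>The path is sampled at the right end of the grid cell of width \<open>1 / Suc n\<close>
  containing the time, cut off at \<open>t\<close>. The sampled processes are jointly measurable,
  and right continuity yields pointwise convergence.\<close>

lemma cadlag_adapted_progressively_measurable:
  assumes X: "adapted_process F T X" and c: "cadlag_process P T X"
  shows "progressively_measurable F T X"
  unfolding progressively_measurable_def
proof
  fix t assume t: "t \<in> {0..T}"
  let ?N = "restrict_space borel {0..t} \<Otimes>\<^sub>M F t"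
  have fst_N [measurable]: "fst \<in> borel_measurable ?N"
    using measurable_compose[OF measurable_fst[of "restrict_space borel {0..t}" "F t"]
        measurable_restrict_space1[OF measurable_ident]] by (simp add: id_def)
  \<comment> \<open>The cell index \<open>i\<close> ranges over a countable type. The
    \<open>+ 1\<close> selects the right end of the cell, and \<open>min t\<close> prevents sampling
    after \<open>t\<close>, where values need not be measurable for \<open>F t\<close>.\<close>
  define \<rho> where "\<rho> n i = min t (max 0 ((of_int i + 1) / real (Suc n)))" for n :: nat and i :: int
  have "(\<lambda>z. X (\<rho> n \<lfloor>real (Suc n) * fst z\<rfloor>) (snd z)) \<in> borel_measurable ?N" for n
  proof (rule measurable_compose_countable)
    fix i
    have r: "0 \<le> \<rho> n i" "\<rho> n i \<le> t"
      using t by (auto simp: \<rho>_def)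
    then have "X (\<rho> n i) \<in> borel_measurable (F t)"
      by (rule measurable_F_mono[rotated]) (use X t r in \<open>auto simp: adapted_process_def\<close>)
    then show "(\<lambda>z. X (\<rho> n i) (snd z)) \<in> borel_measurable ?N"
      by measurable
  qed measurable
  then show "(\<lambda>(s, \<omega>). X s \<omega>) \<in> borel_measurable ?N"
  proof (rule borel_measurable_LIMSEQ_metric)
    fix z assume "z \<in> space ?N"
    then obtain s \<omega> where z: "z = (s, \<omega>)" "0 \<le> s" "s \<le> t" "\<omega> \<in> space P"
      using t subalgebra_F[OF t] by (auto simp: space_pair_measure subalgebra_def)
    define r where "r n = \<rho> n \<lfloor>real (Suc n) * s\<rfloor>" for n
    have grid: "s < (of_int \<lfloor>real (Suc n) * s\<rfloor> + 1) / real (Suc n)"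
      "(of_int \<lfloor>real (Suc n) * s\<rfloor> + 1) / real (Suc n) \<le> s + inverse (real (Suc n))" for n
    proof -
      have "real (Suc n) * s < of_int \<lfloor>real (Suc n) * s\<rfloor> + 1"
        "of_int \<lfloor>real (Suc n) * s\<rfloor> \<le> real (Suc n) * s"
        by linarith+
      then show "s < (of_int \<lfloor>real (Suc n) * s\<rfloor> + 1) / real (Suc n)"
        "(of_int \<lfloor>real (Suc n) * s\<rfloor> + 1) / real (Suc n) \<le> s + inverse (real (Suc n))"
        by (simp_all add: field_simps del: of_nat_Suc)
    qed
    have r_eq: "r n = min t ((of_int \<lfloor>real (Suc n) * s\<rfloor> + 1) / real (Suc n))" for n
      using grid(1)[of n] z by (simp add: r_def \<rho>_def del: of_nat_Suc)
    have "(\<lambda>n. X (r n) \<omega>) \<longlonglongrightarrow> X s \<omega>"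
    proof (cases "s = t")
      \<comment> \<open>At \<open>s = t\<close> the cut-off returns \<open>t\<close> itself, so
        right continuity is invoked only for \<open>s < t\<close>, where the sample times stay
        strictly to the right of \<open>s\<close>.\<close>
      case True
      then have "r n = s" for n
        using grid(1)[of n] by (simp add: r_eq del: of_nat_Suc)
      then show ?thesis by simp
    next
      case False
      then have st: "s < t" using z by simp
      have gt: "s < r n" for n
        using grid(1)[of n] st by (simp add: r_eq del: of_nat_Suc)
      have le: "r n \<le> s + inverse (real (Suc n))" for n
        using grid(2)[of n] by (simp add: r_eq min_le_iff_disj del: of_nat_Suc)
      have "r \<longlonglongrightarrow> s"
        by (rule tendsto_sandwich[OF _ _ tendsto_const LIMSEQ_inverse_real_of_nat_add])
          (use gt le in \<open>auto intro!: always_eventually less_imp_le simp del: of_nat_Suc\<close>)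
      then have "filterlim r (at_right s) sequentially"
        using gt by (auto simp: filterlim_at intro!: always_eventually)
      moreover have "((\<lambda>t. X t \<omega>) \<longlongrightarrow> X s \<omega>) (at_right s)"
        using c z st t by (auto simp: cadlag_process_def cadlag_on_def continuous_within)
      ultimately show ?thesis
        by (rule filterlim_compose[rotated])
    qed
    then show "(\<lambda>n. X (\<rho> n \<lfloor>real (Suc n) * fst z\<rfloor>) (snd z)) \<longlonglongrightarrow> (case z of (s, \<omega>) \<Rightarrow> X s \<omega>)"
      by (simp add: z r_def)
  qed
qed

text \<open>Values outside \<open>{0..T}\<close> are arbitrary. Clamping the time gives joint
  measurability on the whole line, as translations in time and Tonelli's theorem require.\<close>

lemma progressively_measurable_clamp:
  assumes X: "progressively_measurable F T X"
  shows "(\<lambda>(s, \<omega>). X (max 0 (min T s)) \<omega>) \<in> borel_measurable (borel \<Otimes>\<^sub>M P)"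
proof -
  have T: "T \<in> {0..T}" using T_pos by simp
  have "(\<lambda>\<omega>. \<omega>) \<in> measurable P (F T)"
    using measurable_from_subalg[OF subalgebra_F[OF T] measurable_ident] by (simp add: id_def)
  moreover have "(\<lambda>s. max 0 (min T s)) \<in> measurable borel (restrict_space borel {0..T})"
    using T_pos by (intro measurable_restrict_space2) auto
  ultimately have "(\<lambda>z. (max 0 (min T (fst z)), snd z))
      \<in> measurable (borel \<Otimes>\<^sub>M P) (restrict_space borel {0..T} \<Otimes>\<^sub>M F T)"
    by measurable
  then have "(\<lambda>z. case (max 0 (min T (fst z)), snd z) of (s, \<omega>) \<Rightarrow> X s \<omega>)
      \<in> borel_measurable (borel \<Otimes>\<^sub>M P)"
    by (rule measurable_compose) (use X T in \<open>auto simp: progressively_measurable_def\<close>)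
  then show ?thesis by (simp add: case_prod_unfold)
qed

section \<open>Translation modulus of the martingale part and of sums\<close>

text \<open>The relation between \<open>Z\<close>, \<open>X\<close> and \<open>Y\<close> is required
  of increments only, so a common initial value such as \<xi> at time 0 drops out.\<close>

lemma translation_modulus_add_le:
  assumes X: "progressively_measurable F T X" and Y: "progressively_measurable F T Y"
    and Z: "\<And>t s \<omega>. t \<in> {0..T} \<Longrightarrow> s \<in> {0..T} \<Longrightarrow> \<omega> \<in> space P \<Longrightarrow>
      Z t \<omega> - Z s \<omega> = (X t \<omega> - X s \<omega>) + (Y t \<omega> - Y s \<omega>)"
    and h: "0 < h"
  shows "translation_modulus P T Z h \<le> 2 * translation_modulus P T X h + 2 * translation_modulus P T Y h"
proof -
  let ?m = "\<lambda>t. max (t - h) 0"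
  define c where "c V t \<omega> = V (max 0 (min T t)) \<omega>" for V :: "real \<Rightarrow> 'a \<Rightarrow> real" and t \<omega>
  define f where "f V \<omega> t = ennreal ((c V t \<omega> - c V (?m t) \<omega>)\<^sup>2) * indicator {0..T} t" for V t \<omega>
  have [measurable]: "(\<lambda>(t, \<omega>). c X t \<omega>) \<in> borel_measurable (borel \<Otimes>\<^sub>M P)"
    "(\<lambda>(t, \<omega>). c Y t \<omega>) \<in> borel_measurable (borel \<Otimes>\<^sub>M P)"
    unfolding c_def using X Y by (simp_all add: progressively_measurable_clamp)
  have f_meas [measurable]: "(\<lambda>(\<omega>, t). f X \<omega> t) \<in> borel_measurable (P \<Otimes>\<^sub>M borel)"
    "(\<lambda>(\<omega>, t). f Y \<omega> t) \<in> borel_measurable (P \<Otimes>\<^sub>M borel)"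
    unfolding f_def by measurable
  have eq: "translation_modulus P T V h = (\<integral>\<^sup>+\<omega>. (\<integral>\<^sup>+t. f V \<omega> t \<partial>lborel) \<partial>P)" for V
    unfolding translation_modulus_def f_def c_def using h
    by (intro nn_integral_cong) (auto simp: indicator_def)
  have "f Z \<omega> t \<le> 2 * f X \<omega> t + 2 * f Y \<omega> t" if "\<omega> \<in> space P" for \<omega> t
    using that T_pos ennreal_sq_add_le by (auto simp: f_def c_def indicator_def Z)
  then have "translation_modulus P T Z h \<le> (\<integral>\<^sup>+\<omega>. (\<integral>\<^sup>+t. 2 * f X \<omega> t + 2 * f Y \<omega> t \<partial>lborel) \<partial>P)"
    unfolding eq by (intro nn_integral_mono)
  also have "\<dots> = (\<integral>\<^sup>+\<omega>. 2 * (\<integral>\<^sup>+t. f X \<omega> t \<partial>lborel) + 2 * (\<integral>\<^sup>+t. f Y \<omega> t \<partial>lborel) \<partial>P)"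
    by (intro nn_integral_cong) (simp add: nn_integral_add nn_integral_cmult)
  also have "\<dots> = 2 * translation_modulus P T X h + 2 * translation_modulus P T Y h"
    unfolding eq by (simp add: nn_integral_add nn_integral_cmult)
  finally show ?thesis .
qed

text \<open>Conditioning \<open>M t\<close> on \<open>F s\<close> shows that the mixed moment of
  \<open>M s\<close> and \<open>M t\<close> equals the second moment of \<open>M s\<close>;
  expanding the square then gives the claim.\<close>

lemma square_integrable_martingale_increment:
  assumes M: "square_integrable_martingale P F T M" and st: "0 \<le> s" "s \<le> t" "t \<le> T"
  shows "integrable P (\<lambda>\<omega>. (M t \<omega> - M s \<omega>)\<^sup>2)"
    and "(\<integral>\<omega>. (M t \<omega> - M s \<omega>)\<^sup>2 \<partial>P) = (\<integral>\<omega>. (M t \<omega>)\<^sup>2 \<partial>P) - (\<integral>\<omega>. (M s \<omega>)\<^sup>2 \<partial>P)"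
proof -
  have mart: "martingale P F T M" and sq: "\<And>r. r \<in> {0..T} \<Longrightarrow> integrable P (\<lambda>\<omega>. (M r \<omega>)\<^sup>2)"
    using M by (auto simp: square_integrable_martingale_def)
  have Ms: "M s \<in> borel_measurable (F s)" and Mt: "M t \<in> borel_measurable (F t)"
    using mart st by (auto simp: martingale_def adapted_process_def)
  have [measurable]: "M s \<in> borel_measurable P" "M t \<in> borel_measurable P"
    using measurable_F[OF Ms] measurable_F[OF Mt] st by auto
  interpret S: finite_measure_subalgebra P "F s"
    using subalgebra_F[of s] st by unfold_locales auto
  have sq_s: "integrable P (\<lambda>\<omega>. (M s \<omega>)\<^sup>2)" and sq_t: "integrable P (\<lambda>\<omega>. (M t \<omega>)\<^sup>2)"
    using sq st by auto
  have prod: "integrable P (\<lambda>\<omega>. M s \<omega> * M t \<omega>)"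
  proof (rule Bochner_Integration.integrable_bound)
    show "integrable P (\<lambda>\<omega>. (M s \<omega>)\<^sup>2 + (M t \<omega>)\<^sup>2)"
      using sq_s sq_t by simp
    have "\<bar>a * b\<bar> \<le> a\<^sup>2 + b\<^sup>2" for a b :: real
      using sum_squares_bound[of "\<bar>a\<bar>" "\<bar>b\<bar>"] abs_ge_zero[of "a * b"]
      unfolding abs_mult power2_abs by linarith
    then show "AE \<omega> in P. norm (M s \<omega> * M t \<omega>) \<le> norm ((M s \<omega>)\<^sup>2 + (M t \<omega>)\<^sup>2)"
      by simp
  qed simp
  have "(\<integral>\<omega>. M s \<omega> * M t \<omega> \<partial>P) = (\<integral>\<omega>. M s \<omega> * real_cond_exp P (F s) (M t) \<omega> \<partial>P)"
    using S.real_cond_exp_intg(2)[OF prod Ms] by simp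
  also have "\<dots> = (\<integral>\<omega>. M s \<omega> * M s \<omega> \<partial>P)"
  proof (rule integral_cong_AE)
    have "AE \<omega> in P. real_cond_exp P (F s) (M t) \<omega> = M s \<omega>"
      using mart st by (simp add: martingale_def)
    then show "AE \<omega> in P. M s \<omega> * real_cond_exp P (F s) (M t) \<omega> = M s \<omega> * M s \<omega>"
      by eventually_elim simp
  qed measurable
  finally have cross: "(\<integral>\<omega>. M s \<omega> * M t \<omega> \<partial>P) = (\<integral>\<omega>. (M s \<omega>)\<^sup>2 \<partial>P)"
    by (simp add: power2_eq_square)
  have exp: "(M t \<omega> - M s \<omega>)\<^sup>2 = (M t \<omega>)\<^sup>2 + (M s \<omega>)\<^sup>2 - 2 * (M s \<omega> * M t \<omega>)" for \<omega>
    by (simp add: power2_diff)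
  show "integrable P (\<lambda>\<omega>. (M t \<omega> - M s \<omega>)\<^sup>2)"
    unfolding exp using sq_s sq_t prod by simp
  show "(\<integral>\<omega>. (M t \<omega> - M s \<omega>)\<^sup>2 \<partial>P) = (\<integral>\<omega>. (M t \<omega>)\<^sup>2 \<partial>P) - (\<integral>\<omega>. (M s \<omega>)\<^sup>2 \<partial>P)"
    unfolding exp using sq_s sq_t prod cross by simp
qed

text \<open>The compensated square \<open>(M t)\<^sup>2 - QV t\<close> is a martingale that vanishes
  almost surely at time 0, so its expectation at \<open>T\<close> is 0.\<close>

lemma nn_integral_predictable_quadratic_variation:
  assumes M: "square_integrable_martingale P F T M" and M0: "AE \<omega> in P. M 0 \<omega> = 0"
    and QV: "predictable_quadratic_variation P F T M QV"
  shows "(\<integral>\<^sup>+\<omega>. ennreal (QV T \<omega>) \<partial>P) = ennreal (\<integral>\<omega>. (M T \<omega>)\<^sup>2 \<partial>P)"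
proof -
  let ?N = "\<lambda>t \<omega>. (M t \<omega>)\<^sup>2 - QV t \<omega>"
  have T: "0 \<le> T" using T_pos by simp
  have N: "martingale P F T ?N"
    and QV_AE: "AE \<omega> in P. QV 0 \<omega> = 0 \<and> mono_on {0..T} (\<lambda>t. QV t \<omega>)"
    using QV by (auto simp: predictable_quadratic_variation_def)
  have int_N: "integrable P (?N T)" "integrable P (?N 0)"
    and cond_N: "AE \<omega> in P. real_cond_exp P (F 0) (?N T) \<omega> = ?N 0 \<omega>"
    using N T by (auto simp: martingale_def)
  have int_M: "integrable P (\<lambda>\<omega>. (M T \<omega>)\<^sup>2)"
    using M T by (auto simp: square_integrable_martingale_def)
  interpret S: finite_measure_subalgebra P "F 0"
    using subalgebra_F[of 0] T by unfold_locales auto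
  have "(\<integral>\<omega>. ?N T \<omega> \<partial>P) = (\<integral>\<omega>. real_cond_exp P (F 0) (?N T) \<omega> \<partial>P)"
    using S.real_cond_exp_int(2)[OF int_N(1)] by simp
  also have "\<dots> = (\<integral>\<omega>. 0 \<partial>P)"
  proof (rule integral_cong_AE)
    show "AE \<omega> in P. real_cond_exp P (F 0) (?N T) \<omega> = 0"
      using cond_N M0 QV_AE by eventually_elim simp
  qed simp_all
  finally have N0: "(\<integral>\<omega>. ?N T \<omega> \<partial>P) = 0"
    by simp
  have "integrable P (\<lambda>\<omega>. (M T \<omega>)\<^sup>2 - ?N T \<omega>)"
    using int_M int_N(1) by (rule Bochner_Integration.integrable_diff)
  then have int_Q: "integrable P (QV T)" by simp
  \<comment> \<open>Nonnegativity lets the \<open>ennreal\<close> expectation agree with the Bochner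
    one; it follows from the monotone paths starting at 0.\<close>
  have "AE \<omega> in P. 0 \<le> QV T \<omega>"
    using QV_AE by eventually_elim (use T in \<open>force simp: mono_on_def\<close>)
  then have "(\<integral>\<^sup>+\<omega>. ennreal (QV T \<omega>) \<partial>P) = ennreal (\<integral>\<omega>. QV T \<omega> \<partial>P)"
    using int_Q by (intro nn_integral_eq_integral)
  also have "(\<integral>\<omega>. QV T \<omega> \<partial>P) = (\<integral>\<omega>. (M T \<omega>)\<^sup>2 \<partial>P)"
    using N0 int_M int_Q by simp
  finally show ?thesis .
qed

lemma pair_sigma_finite_lborel: "pair_sigma_finite lborel P"
  by (simp add: pair_sigma_finite_def lborel.sigma_finite_measure_axioms sigma_finite_measure_axioms)

text \<open>Paths of \<open>M\<close> may have infinite variation, so no pathwise bound is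
  available. Expectation and time integral are exchanged first, and the telescoping bound is applied
  to the second moment, which is nondecreasing by orthogonality.\<close>

lemma translation_modulus_martingale_le:
  assumes M: "square_integrable_martingale P F T M" and c: "cadlag_process P T M"
    and h: "0 < h" "h \<le> T"
  shows "translation_modulus P T M h \<le> ennreal h * ennreal (\<integral>\<omega>. (M T \<omega>)\<^sup>2 \<partial>P)"
proof -
  interpret pair_sigma_finite lborel P by (rule pair_sigma_finite_lborel)
  define q where "q t = (\<integral>\<omega>. (M t \<omega>)\<^sup>2 \<partial>P)" for t
  have incr: "(\<integral>\<^sup>+\<omega>. ennreal ((M t \<omega> - M s \<omega>)\<^sup>2) \<partial>P) = ennreal (q t - q s)"
    and q_mono: "q s \<le> q t" if "0 \<le> s" "s \<le> t" "t \<le> T" for s t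
  proof -
    note inc = square_integrable_martingale_increment[OF M that]
    show "(\<integral>\<^sup>+\<omega>. ennreal ((M t \<omega> - M s \<omega>)\<^sup>2) \<partial>P) = ennreal (q t - q s)"
      using nn_integral_eq_integral[OF inc(1)] inc(2) by (simp add: q_def)
    have "0 \<le> (\<integral>\<omega>. (M t \<omega> - M s \<omega>)\<^sup>2 \<partial>P)"
      by simp
    then show "q s \<le> q t"
      unfolding inc(2) by (simp add: q_def)
  qed
  have "mono_on {0..T} q"
    by (intro mono_onI q_mono) auto
  define N where "N t \<omega> = M (max 0 (min T t)) \<omega>" for t \<omega>
  have [measurable]: "(\<lambda>(t, \<omega>). N t \<omega>) \<in> borel_measurable (borel \<Otimes>\<^sub>M P)"
    unfolding N_def using M c
    by (intro progressively_measurable_clamp cadlag_adapted_progressively_measurable)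
      (auto simp: square_integrable_martingale_def martingale_def)
  have "translation_modulus P T M h
      = (\<integral>\<^sup>+\<omega>. (\<integral>\<^sup>+t\<in>{0..T}. ennreal ((N t \<omega> - N (max (t - h) 0) \<omega>)\<^sup>2) \<partial>lborel) \<partial>P)"
    unfolding translation_modulus_def N_def using h
    by (intro nn_integral_cong) (auto simp: indicator_def)
  also have "\<dots> = (\<integral>\<^sup>+t. (\<integral>\<^sup>+\<omega>. ennreal ((N t \<omega> - N (max (t - h) 0) \<omega>)\<^sup>2) * indicator {0..T} t \<partial>P) \<partial>lborel)"
    by (rule Fubini') measurable
  also have "\<dots> = (\<integral>\<^sup>+t\<in>{0..T}. ennreal (q t - q (max (t - h) 0)) \<partial>lborel)"
    using h by (intro nn_integral_cong) (auto simp: indicator_def N_def incr)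
  also have "\<dots> \<le> ennreal h * ennreal (q T - q 0)"
    using \<open>mono_on {0..T} q\<close> h by (rule nn_integral_mono_translation_le)
  also have "\<dots> \<le> ennreal h * ennreal (q T)"
    by (intro mult_left_mono ennreal_leI) (auto simp: q_def)
  finally show ?thesis
    by (simp add: q_def)
qed

section \<open>Upper bound for the value function\<close>

lemma nn_integral_sq_diff_const_finite:
  fixes f :: "'a \<Rightarrow> real"
  assumes [measurable]: "f \<in> borel_measurable P" and f: "integrable P (\<lambda>\<omega>. (f \<omega>)\<^sup>2)"
  shows "(\<integral>\<^sup>+\<omega>. ennreal ((f \<omega> - c)\<^sup>2) \<partial>P) < \<infinity>"
proof -
  have "(\<integral>\<^sup>+\<omega>. ennreal ((f \<omega> - c)\<^sup>2) \<partial>P) \<le> (\<integral>\<^sup>+\<omega>. 2 * ennreal ((f \<omega>)\<^sup>2) + 2 * ennreal (c\<^sup>2) \<partial>P)"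
    using ennreal_sq_add_le[of "f _" "- c"] by (intro nn_integral_mono) simp
  also have "\<dots> = 2 * ennreal (\<integral>\<omega>. (f \<omega>)\<^sup>2 \<partial>P) + 2 * ennreal (c\<^sup>2)"
    using nn_integral_eq_integral[OF f]
    by (simp add: nn_integral_add nn_integral_cmult emeasure_space_1)
  also have "\<dots> < \<infinity>"
    by (simp add: ennreal_mult_less_top)
  finally show ?thesis .
qed

text \<open>The window length \<open>h\<close> is left free so that it can be tuned to \<kappa>
  later. The summand \<open>h\<close> comes from the tracking error and \<open>\<kappa> / h\<close>
  from the energy; the last integral is the price of the initial jump from \<open>x\<close> to
  \<open>\<xi> 0\<close>.\<close>

lemma value_function_le:
  assumes prog: "progressively_measurable F T \<xi>" and \<xi>0: "integrable P (\<lambda>\<omega>. (\<xi> 0 \<omega>)\<^sup>2)"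
    and K: "\<And>r. 0 < r \<Longrightarrow> translation_modulus P T \<xi> r \<le> K * ennreal r" and K_fin: "K < \<infinity>"
    and h: "0 < h" and \<kappa>: "0 \<le> \<kappa>"
  shows "value_function P F T x \<xi> \<kappa>
    \<le> ennreal (h + \<kappa> / h) * (2 * K + 2 * (\<integral>\<^sup>+\<omega>. ennreal ((\<xi> 0 \<omega> - x)\<^sup>2) \<partial>P))"
proof -
  interpret pair_sigma_finite lborel P by (rule pair_sigma_finite_lborel)
  define C where "C = 2 * K + 2 * (\<integral>\<^sup>+\<omega>. ennreal ((\<xi> 0 \<omega> - x)\<^sup>2) \<partial>P)"
  define g where "g s \<omega> = (if s < 0 then x else \<xi> (max 0 (min T s)) \<omega>)" for s \<omega>
  have g_meas [measurable]: "(\<lambda>(s, \<omega>). g s \<omega>) \<in> borel_measurable (borel \<Otimes>\<^sub>M P)"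
    unfolding g_def case_prod_unfold
    using progressively_measurable_clamp[OF prog, unfolded case_prod_unfold]
    by (intro measurable_If) auto
  have g_eq: "g t \<omega> = \<xi> t \<omega>" if "0 \<le> t" "t \<le> T" for t \<omega>
    using that by (simp add: g_def)
  have g_neg: "g t \<omega> = x" if "t < 0" for t \<omega>
    using that by (simp add: g_def)
  have [measurable]: "\<xi> 0 \<in> borel_measurable P"
  proof -
    have "(\<lambda>\<omega>. g 0 \<omega>) \<in> borel_measurable P" by measurable
    then show ?thesis using T_pos by (simp add: g_def)
  qed
  have C_fin: "C < \<infinity>"
    using nn_integral_sq_diff_const_finite[OF _ \<xi>0, of x] K_fin
    by (simp add: C_def ennreal_mult_less_top)
  \<comment> \<open>This is the translation modulus of the extended path \<open>g\<close>: the
    lagged time \<open>t - r\<close> may be negative.\<close>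
  define W where "W r = (\<integral>\<^sup>+\<omega>. (\<integral>\<^sup>+t\<in>{0..T}. ennreal ((g t \<omega> - g (t - r) \<omega>)\<^sup>2) \<partial>lborel) \<partial>P)" for r
  have W_le: "W r \<le> ennreal r * C" if r: "0 \<le> r" for r
  proof (cases "r = 0")
    case True
    then show ?thesis by (simp add: W_def)
  next
    case False
    with r have r: "0 < r" by simp
    have mod: "translation_modulus P T \<xi> r
        = (\<integral>\<^sup>+\<omega>. (\<integral>\<^sup>+t\<in>{0..T}. ennreal ((g t \<omega> - g (max (t - r) 0) \<omega>)\<^sup>2) \<partial>lborel) \<partial>P)"
      unfolding translation_modulus_def using r
      by (intro nn_integral_cong) (auto simp: indicator_def g_eq)
    \<comment> \<open>If \<open>t < r\<close>, the lagged value is \<open>x\<close> and the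
      increment is split at \<open>\<xi> 0\<close>. Such times lie in \<open>{0..r}\<close>, so the
      extra term also contributes only a multiple of \<open>r\<close>.\<close>
    have pt: "ennreal ((g t \<omega> - g (t - r) \<omega>)\<^sup>2) * indicator {0..T} t
        \<le> 2 * (ennreal ((g t \<omega> - g (max (t - r) 0) \<omega>)\<^sup>2) * indicator {0..T} t)
          + 2 * ennreal ((\<xi> 0 \<omega> - x)\<^sup>2) * indicator {0..r} t" for t \<omega>
    proof (cases "t \<in> {0..T}")
      case t: True
      show ?thesis
      proof (cases "t < r")
        case True
        then have "g (t - r) \<omega> = x" "g (max (t - r) 0) \<omega> = \<xi> 0 \<omega>"
          using t T_pos by (auto simp: g_def)
        then show ?thesis
          using t True ennreal_sq_add_le[of "g t \<omega> - \<xi> 0 \<omega>" "\<xi> 0 \<omega> - x"] by simp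
      next
        case False
        then have "max (t - r) 0 = t - r" by simp
        moreover have "a \<le> 2 * a + b" for a b :: ennreal
          by (simp add: mult_2 add.assoc add_increasing2)
        ultimately show ?thesis using t by simp
      qed
    qed simp
    have "W r \<le> (\<integral>\<^sup>+\<omega>. (\<integral>\<^sup>+t. 2 * (ennreal ((g t \<omega> - g (max (t - r) 0) \<omega>)\<^sup>2) * indicator {0..T} t)
          + (2 * ennreal ((\<xi> 0 \<omega> - x)\<^sup>2)) * indicator {0..r} t \<partial>lborel) \<partial>P)"
      unfolding W_def by (intro nn_integral_mono pt)
    also have "\<dots> = (\<integral>\<^sup>+\<omega>. 2 * (\<integral>\<^sup>+t\<in>{0..T}. ennreal ((g t \<omega> - g (max (t - r) 0) \<omega>)\<^sup>2) \<partial>lborel)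
          + ennreal r * (2 * ennreal ((\<xi> 0 \<omega> - x)\<^sup>2)) \<partial>P)"
      using r by (intro nn_integral_cong)
        (simp add: nn_integral_add nn_integral_cmult nn_integral_cmult_indicator mult.commute[of "ennreal r"])
    also have "\<dots> = 2 * translation_modulus P T \<xi> r
        + ennreal r * (2 * (\<integral>\<^sup>+\<omega>. ennreal ((\<xi> 0 \<omega> - x)\<^sup>2) \<partial>P))"
      unfolding mod by (simp add: nn_integral_add nn_integral_cmult)
    also have "\<dots> \<le> 2 * (K * ennreal r) + ennreal r * (2 * (\<integral>\<^sup>+\<omega>. ennreal ((\<xi> 0 \<omega> - x)\<^sup>2) \<partial>P))"
      using K[OF r] by (intro add_right_mono mult_left_mono) auto
    also have "\<dots> = ennreal r * C"
      by (simp add: C_def distrib_left mult_ac)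
    finally show ?thesis .
  qed
  define u where "u s \<omega> = (g s \<omega> - g (s - h) \<omega>) / h" for s \<omega>
  have u_prog: "progressively_measurable F T u"
    unfolding progressively_measurable_def
  proof
    fix t assume t: "t \<in> {0..T}"
    let ?N = "restrict_space borel {0..t} \<Otimes>\<^sub>M F t"
    have [measurable]: "(\<lambda>(s, \<omega>). \<xi> s \<omega>) \<in> borel_measurable ?N"
      using prog t by (auto simp: progressively_measurable_def)
    have fst_N [measurable]: "fst \<in> borel_measurable ?N"
      using measurable_compose[OF measurable_fst[of "restrict_space borel {0..t}" "F t"]
        measurable_restrict_space1[OF measurable_ident]] by (simp add: id_def)
    \<comment> \<open>The lagged time stays in \<open>{0..t}\<close>, so the lagged target is the
      progressively measurable one composed with a measurable map of \<open>?N\<close> into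
      itself.\<close>
    have "(\<lambda>z. max 0 (fst z - h)) \<in> measurable ?N (restrict_space borel {0..t})"
      using h by (intro measurable_restrict_space2) (auto simp: space_pair_measure)
    then have "(\<lambda>z. (max 0 (fst z - h), snd z)) \<in> measurable ?N ?N"
      by measurable
    then have [measurable]: "(\<lambda>z. \<xi> (max 0 (fst z - h)) (snd z)) \<in> borel_measurable ?N"
      using measurable_compose[of "\<lambda>z. (max 0 (fst z - h), snd z)" ?N ?N "\<lambda>(s, \<omega>). \<xi> s \<omega>" borel] by simp
    have "(\<lambda>z. (\<xi> (fst z) (snd z) - (if fst z < h then x else \<xi> (max 0 (fst z - h)) (snd z))) / h)
        \<in> borel_measurable ?N"
      by measurable
    also have "?this \<longleftrightarrow> (\<lambda>(s, \<omega>). u s \<omega>) \<in> borel_measurable ?N"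
      using t h by (intro measurable_cong) (auto simp: space_pair_measure u_def g_def)
    finally show "(\<lambda>(s, \<omega>). u s \<omega>) \<in> borel_measurable ?N" .
  qed
  have u_sq: "ennreal ((u t \<omega>)\<^sup>2) = ennreal (1 / h\<^sup>2) * ennreal ((g t \<omega> - g (t - h) \<omega>)\<^sup>2)" for t \<omega>
    by (simp add: u_def power_divide ennreal_mult[symmetric])
  have energy: "(\<integral>\<^sup>+\<omega>. (\<integral>\<^sup>+t\<in>{0..T}. ennreal ((u t \<omega>)\<^sup>2) \<partial>lborel) \<partial>P) \<le> ennreal (1 / h) * C"
  proof -
    have "(\<integral>\<^sup>+\<omega>. (\<integral>\<^sup>+t\<in>{0..T}. ennreal ((u t \<omega>)\<^sup>2) \<partial>lborel) \<partial>P) = ennreal (1 / h\<^sup>2) * W h"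
    proof -
      have "(\<integral>\<^sup>+t\<in>{0..T}. ennreal ((u t \<omega>)\<^sup>2) \<partial>lborel)
          = ennreal (1 / h\<^sup>2) * (\<integral>\<^sup>+t\<in>{0..T}. ennreal ((g t \<omega> - g (t - h) \<omega>)\<^sup>2) \<partial>lborel)"
        if [measurable]: "\<omega> \<in> space P" for \<omega>
        unfolding u_sq by (simp add: nn_integral_cmult mult.assoc)
      then have "(\<integral>\<^sup>+\<omega>. (\<integral>\<^sup>+t\<in>{0..T}. ennreal ((u t \<omega>)\<^sup>2) \<partial>lborel) \<partial>P)
          = (\<integral>\<^sup>+\<omega>. ennreal (1 / h\<^sup>2) * (\<integral>\<^sup>+t\<in>{0..T}. ennreal ((g t \<omega> - g (t - h) \<omega>)\<^sup>2) \<partial>lborel) \<partial>P)"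
        by (rule nn_integral_cong)
      then show ?thesis
        unfolding W_def by (simp add: nn_integral_cmult)
    qed
    also have "\<dots> \<le> ennreal (1 / h\<^sup>2) * (ennreal h * C)"
      using h by (intro mult_left_mono W_le) auto
    also have "\<dots> = ennreal (1 / h) * C"
      using h by (simp add: mult.assoc[symmetric] ennreal_mult[symmetric] power2_eq_square)
    finally show ?thesis .
  qed
  have u_adm: "u \<in> admissible_controls P F T"
    using u_prog le_less_trans[OF energy] C_fin
    by (simp add: admissible_controls_def ennreal_mult_less_top)
  \<comment> \<open>A lag of \<open>2 * T\<close> carries every time of \<open>{0..T}\<close> below
    0, where \<open>g\<close> is \<open>x\<close>. Finiteness of \<open>W (2 * T)\<close> thus says
    that the target minus \<open>x\<close> is square integrable, which makes almost every path
    integrable and keeps the state formula away from the default value 0 of the Bochner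
    integral.\<close>
  have "W (2 * T) < \<infinity>"
    using le_less_trans[OF W_le[of "2 * T"]] C_fin T_pos by (simp add: ennreal_mult_less_top)
  then have "AE \<omega> in P. (\<integral>\<^sup>+t\<in>{0..T}. ennreal ((g t \<omega> - g (t - 2 * T) \<omega>)\<^sup>2) \<partial>lborel) \<noteq> \<infinity>"
    unfolding W_def by (intro nn_integral_noteq_infinite) auto
  with AE_space have paths: "AE \<omega> in P. \<forall>a b. set_integrable lborel {a..b} (\<lambda>s. g s \<omega>)"
  proof (eventually_elim, intro allI)
    fix \<omega> a b
    assume [measurable]: "\<omega> \<in> space P"
      and fin: "(\<integral>\<^sup>+t\<in>{0..T}. ennreal ((g t \<omega> - g (t - 2 * T) \<omega>)\<^sup>2) \<partial>lborel) \<noteq> \<infinity>"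
    \<comment> \<open>Outside \<open>{0..T}\<close> the path is constantly \<open>x\<close> or
      \<open>\<xi> T\<close>; the \<open>+ 1\<close> comes from bounding an absolute value by one
      plus its square on \<open>{0..T}\<close>.\<close>
    define c where "c = \<bar>x\<bar> + \<bar>\<xi> T \<omega>\<bar> + 1"
    have c: "0 \<le> c" by (simp add: c_def)
    have bound: "\<bar>g s \<omega>\<bar> \<le> c + (if s \<in> {0..T} then (g s \<omega> - g (s - 2 * T) \<omega>)\<^sup>2 else 0)" for s
    proof (cases "s \<in> {0..T}")
      case True
      then have "g (s - 2 * T) \<omega> = x"
        using T_pos by (intro g_neg) auto
      moreover have "\<bar>d\<bar> \<le> 1 + d\<^sup>2" for d :: real
        using sum_squares_bound[of "\<bar>d\<bar>" 1] abs_ge_zero[of d] unfolding power2_abs by simp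
      from this[of "g s \<omega> - x"] have "\<bar>g s \<omega>\<bar> \<le> \<bar>x\<bar> + 1 + (g s \<omega> - x)\<^sup>2"
        by linarith
      ultimately show ?thesis
        using True by (simp add: c_def)
    next
      case False
      then show ?thesis
        using T_pos by (auto simp: g_def c_def)
    qed
    have "(\<integral>\<^sup>+s. ennreal (norm (indicator {a..b} s *\<^sub>R g s \<omega>)) \<partial>lborel)
        \<le> (\<integral>\<^sup>+s. ennreal c * indicator {a..b} s
            + ennreal ((g s \<omega> - g (s - 2 * T) \<omega>)\<^sup>2) * indicator {0..T} s \<partial>lborel)"
    proof (intro nn_integral_mono)
      fix s
      have "ennreal \<bar>g s \<omega>\<bar> \<le> ennreal c + ennreal ((g s \<omega> - g (s - 2 * T) \<omega>)\<^sup>2) * indicator {0..T} s"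
        using ennreal_leI[OF bound[of s]] c by (auto simp: indicator_def split: if_splits)
      then show "ennreal (norm (indicator {a..b} s *\<^sub>R g s \<omega>)) \<le> ennreal c * indicator {a..b} s
            + ennreal ((g s \<omega> - g (s - 2 * T) \<omega>)\<^sup>2) * indicator {0..T} s"
        by (auto simp: indicator_def)
    qed
    also have "\<dots> = ennreal c * emeasure lborel {a..b}
        + (\<integral>\<^sup>+t\<in>{0..T}. ennreal ((g t \<omega> - g (t - 2 * T) \<omega>)\<^sup>2) \<partial>lborel)"
      by (simp add: nn_integral_add nn_integral_cmult)
    also have "\<dots> < \<infinity>"
      using fin emeasure_lborel_Icc_eq[of a b] by (auto simp: less_top ennreal_mult_less_top)
    finally show "set_integrable lborel {a..b} (\<lambda>s. g s \<omega>)"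
      unfolding set_integrable_def by (intro integrableI_bounded) auto
  qed
  let ?G = "\<lambda>\<omega> t r. ennreal ((g t \<omega> - g (t - r) \<omega>)\<^sup>2) * indicator {0..h} r * indicator {0..T} t"
  have track: "AE \<omega> in P. (\<integral>\<^sup>+t\<in>{0..T}. ennreal ((controlled_state x u t \<omega> - \<xi> t \<omega>)\<^sup>2) \<partial>lborel)
      \<le> ennreal (1 / h) * (\<integral>\<^sup>+t. (\<integral>\<^sup>+r. ?G \<omega> t r \<partial>lborel) \<partial>lborel)"
    using paths AE_space
  proof eventually_elim
    case (elim \<omega>)
    have [measurable]: "\<omega> \<in> space P" by fact
    have "ennreal ((controlled_state x u t \<omega> - \<xi> t \<omega>)\<^sup>2) * indicator {0..T} t
        \<le> ennreal (1 / h) * (\<integral>\<^sup>+r. ?G \<omega> t r \<partial>lborel)" for t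
    proof (cases "t \<in> {0..T}")
      case t: True
      note st = steklov_average_eq[of "\<lambda>s. g s \<omega>" x h t]
      have int: "set_integrable lborel {0..h} (\<lambda>r. g (t - r) \<omega>)"
        using elim t h by (intro st(1)) (auto simp: g_neg)
      have "controlled_state x u t \<omega> = 1 / h * (LINT r:{0..h}|lborel. g (t - r) \<omega>)"
        unfolding controlled_state_def u_def using elim t h by (intro st(2)) (auto simp: g_neg)
      moreover have const: "set_integrable lborel {0..h} (\<lambda>r. g t \<omega>)"
        using h by (simp add: set_integrable_def)
      moreover have "(LINT r:{0..h}|lborel. g t \<omega>) = h * \<xi> t \<omega>"
        using h t by (simp add: set_integral_const g_eq)
      \<comment> \<open>The state is an average of \<open>g\<close> over lags in
        \<open>{0..h}\<close>, and \<open>\<xi> t\<close> is the average of the constant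
        \<open>g t\<close>. Hence their difference is an average of increments, ready for
        Jensen.\<close>
      ultimately have "controlled_state x u t \<omega> - \<xi> t \<omega>
          = 1 / h * (LINT r:{0..h}|lborel. g (t - r) \<omega> - g t \<omega>)"
        using int h by (simp add: set_integral_diff field_simps)
      moreover have "ennreal ((1 / h * (LINT r:{0..h}|lborel. g (t - r) \<omega> - g t \<omega>))\<^sup>2)
          \<le> ennreal (1 / h) * (\<integral>\<^sup>+r\<in>{0..h}. ennreal ((g (t - r) \<omega> - g t \<omega>)\<^sup>2) \<partial>lborel)"
        using int const h by (intro set_nn_integral_average_sq_le set_integral_diff)
      ultimately show ?thesis
        using t by (simp add: power2_commute)
    qed simp
    then have "(\<integral>\<^sup>+t\<in>{0..T}. ennreal ((controlled_state x u t \<omega> - \<xi> t \<omega>)\<^sup>2) \<partial>lborel)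
        \<le> (\<integral>\<^sup>+t. ennreal (1 / h) * (\<integral>\<^sup>+r. ?G \<omega> t r \<partial>lborel) \<partial>lborel)"
      by (intro nn_integral_mono)
    also have "\<dots> = ennreal (1 / h) * (\<integral>\<^sup>+t. (\<integral>\<^sup>+r. ?G \<omega> t r \<partial>lborel) \<partial>lborel)"
      by (rule nn_integral_cmult) measurable
    finally show ?case .
  qed
  \<comment> \<open>With the lag outermost, the inner integrals form \<open>W r\<close>, at most
    \<open>h * C\<close> for lags up to \<open>h\<close>; integrating over the lags gives a second
    factor \<open>h\<close>.\<close>
  have swap: "(\<integral>\<^sup>+\<omega>. (\<integral>\<^sup>+t. (\<integral>\<^sup>+r. ?G \<omega> t r \<partial>lborel) \<partial>lborel) \<partial>P) \<le> ennreal h * (ennreal h * C)"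
  proof -
    have "(\<integral>\<^sup>+\<omega>. (\<integral>\<^sup>+t. (\<integral>\<^sup>+r. ?G \<omega> t r \<partial>lborel) \<partial>lborel) \<partial>P)
        = (\<integral>\<^sup>+\<omega>. (\<integral>\<^sup>+r. (\<integral>\<^sup>+t. ?G \<omega> t r \<partial>lborel) \<partial>lborel) \<partial>P)"
    proof (rule nn_integral_cong)
      fix \<omega> assume [measurable]: "\<omega> \<in> space P"
      show "(\<integral>\<^sup>+t. (\<integral>\<^sup>+r. ?G \<omega> t r \<partial>lborel) \<partial>lborel) = (\<integral>\<^sup>+r. (\<integral>\<^sup>+t. ?G \<omega> t r \<partial>lborel) \<partial>lborel)"
        by (rule lborel_pair.Fubini') measurable
    qed
    also have "\<dots> = (\<integral>\<^sup>+r. (\<integral>\<^sup>+\<omega>. (\<integral>\<^sup>+t. ?G \<omega> t r \<partial>lborel) \<partial>P) \<partial>lborel)"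
      by (rule Fubini') measurable
    also have "\<dots> = (\<integral>\<^sup>+r\<in>{0..h}. W r \<partial>lborel)"
      unfolding W_def by (intro nn_integral_cong) (auto simp: indicator_def)
    also have "\<dots> \<le> (\<integral>\<^sup>+r. (ennreal h * C) * indicator {0..h} r \<partial>lborel)"
    proof (intro nn_integral_mono)
      fix r
      have "W r \<le> ennreal h * C" if "0 \<le> r" "r \<le> h"
        using W_le[OF that(1)] that(2) by (meson order_trans mult_right_mono ennreal_leI zero_le)
      then show "W r * indicator {0..h} r \<le> (ennreal h * C) * indicator {0..h} r"
        by (auto simp: indicator_def)
    qed
    also have "\<dots> = ennreal h * (ennreal h * C)"
      using h by (simp add: nn_integral_cmult mult_ac)
    finally show ?thesis .
  qed
  have "value_function P F T x \<xi> \<kappa> \<le> tracking_cost P T x \<xi> \<kappa> u"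
    unfolding value_function_def using u_adm by (rule INF_lower)
  also have "\<dots> \<le> (\<integral>\<^sup>+\<omega>. ennreal (1 / 2) * (ennreal (1 / h) * (\<integral>\<^sup>+t. (\<integral>\<^sup>+r. ?G \<omega> t r \<partial>lborel) \<partial>lborel))
        + ennreal (\<kappa> / 2) * (\<integral>\<^sup>+t\<in>{0..T}. ennreal ((u t \<omega>)\<^sup>2) \<partial>lborel) \<partial>P)"
    unfolding tracking_cost_def
    by (rule nn_integral_mono_AE, use track in eventually_elim) (intro add_right_mono mult_left_mono; simp)
  also have "\<dots> = ennreal (1 / 2) * (ennreal (1 / h) * (\<integral>\<^sup>+\<omega>. (\<integral>\<^sup>+t. (\<integral>\<^sup>+r. ?G \<omega> t r \<partial>lborel) \<partial>lborel) \<partial>P))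
        + ennreal (\<kappa> / 2) * (\<integral>\<^sup>+\<omega>. (\<integral>\<^sup>+t\<in>{0..T}. ennreal ((u t \<omega>)\<^sup>2) \<partial>lborel) \<partial>P)"
    unfolding u_def by (simp add: nn_integral_add nn_integral_cmult)
  also have "\<dots> \<le> ennreal (1 / 2) * (ennreal (1 / h) * (ennreal h * (ennreal h * C)))
        + ennreal (\<kappa> / 2) * (ennreal (1 / h) * C)"
    by (intro add_mono mult_left_mono swap energy) auto
  also have "\<dots> = ennreal (h / 2) * C + ennreal (\<kappa> / (2 * h)) * C"
  proof -
    have comb: "ennreal a * (ennreal b * c) = ennreal (a * b) * c" if "0 \<le> a" for a b c
      using that by (simp add: ennreal_mult' mult.assoc)
    have "1 / 2 * (1 / h * (h * h)) = h / 2" "\<kappa> / 2 * (1 / h) = \<kappa> / (2 * h)"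
      using h by simp_all
    then show ?thesis
      using h \<kappa> by (simp only: comb less_imp_le divide_nonneg_nonneg zero_le_one zero_le_numeral mult.assoc)
  qed
  also have "\<dots> = ennreal (h / 2 + \<kappa> / (2 * h)) * C"
    using h \<kappa> by (simp add: distrib_right)
  \<comment> \<open>The factor 1/2 is given up for a simpler bound.\<close>
  also have "\<dots> \<le> ennreal (h + \<kappa> / h) * C"
    using h \<kappa> by (intro mult_right_mono ennreal_leI add_mono) (auto simp: field_simps)
  finally show ?thesis
    by (simp add: C_def)
qed

end

section \<open>The translation estimate and the square-root rate\<close>

theorem proposition2p5:
  fixes P :: "'a measure" and F :: "real \<Rightarrow> 'a measure" and T x :: real
    and \<xi> M A QV :: "real \<Rightarrow> 'a \<Rightarrow> real"
  assumes "usual_filtered_prob_space P F T"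
    and "\<xi> 0 \<in> borel_measurable (F 0)" and "integrable P (\<lambda>\<omega>. (\<xi> 0 \<omega>)\<^sup>2)"
    and "square_integrable_martingale P F T M" and "cadlag_process P T M"
    and "AE \<omega> in P. M 0 \<omega> = 0"
    and "predictable_quadratic_variation P F T M QV"
    and "adapted_process F T A" and "cadlag_process P T A" and "finite_variation_process P T A"
    and "AE \<omega> in P. A 0 \<omega> = 0"
    and "\<And>t \<omega>. t \<in> {0..T} \<Longrightarrow> \<omega> \<in> space P \<Longrightarrow> \<xi> t \<omega> = \<xi> 0 \<omega> + M t \<omega> + A t \<omega>"
    and "(\<integral>\<^sup>+\<omega>. ennreal (QV T \<omega>) \<partial>P) + (\<integral>\<^sup>+\<omega>. (total_variation T (\<lambda>t. A t \<omega>))\<^sup>2 \<partial>P) < \<infinity>"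
  shows "(\<forall>h. 0 < h \<and> h \<le> T \<longrightarrow>
            translation_modulus P T \<xi> h
              \<le> 2 * ennreal h * (\<integral>\<^sup>+\<omega>. ennreal (QV T \<omega>) \<partial>P)
                + 2 * ennreal h * (\<integral>\<^sup>+\<omega>. (total_variation T (\<lambda>t. A t \<omega>))\<^sup>2 \<partial>P))
       \<and> translation_seminorm_sq P T \<xi> < \<infinity>
       \<and> (\<forall>\<^sub>F \<kappa> in at_right 0. value_function P F T x \<xi> \<kappa> < \<infinity>)
       \<and> (\<lambda>\<kappa>. enn2real (value_function P F T x \<xi> \<kappa>)) \<in> O[at_right 0](sqrt)"
proof -
  interpret usual_filtered_prob_space P F T by fact
  define qv where "qv = (\<integral>\<^sup>+\<omega>. ennreal (QV T \<omega>) \<partial>P)"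
  define tv where "tv = (\<integral>\<^sup>+\<omega>. (total_variation T (\<lambda>t. A t \<omega>))\<^sup>2 \<partial>P)"
  define K where "K = 2 * qv + 2 * tv"
  have K_fin: "K < \<infinity>"
    using assms(13) by (simp add: K_def qv_def tv_def ennreal_mult_less_top)
  have "adapted_process F T M"
    using assms(4) by (simp add: square_integrable_martingale_def martingale_def)
  then have M_prog: "progressively_measurable F T M"
    using assms(5) by (rule cadlag_adapted_progressively_measurable)
  have A_prog: "progressively_measurable F T A"
    using assms(8,9) by (rule cadlag_adapted_progressively_measurable)
  \<comment> \<open>Measurability of the target is inherited from its decomposition:
    \<open>\<xi> 0\<close> is measurable for every \<open>F t\<close>, and the two other summands
    are progressively measurable.\<close>
  have \<xi>_prog: "progressively_measurable F T \<xi>"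
    unfolding progressively_measurable_def
  proof
    fix t assume t: "t \<in> {0..T}"
    let ?N = "restrict_space borel {0..t} \<Otimes>\<^sub>M F t"
    have [measurable]: "(\<lambda>(s, \<omega>). M s \<omega>) \<in> borel_measurable ?N" "(\<lambda>(s, \<omega>). A s \<omega>) \<in> borel_measurable ?N"
      using M_prog A_prog t by (auto simp: progressively_measurable_def)
    have [measurable]: "\<xi> 0 \<in> borel_measurable (F t)"
      using assms(2) t by (auto intro: measurable_F_mono)
    have "(\<lambda>z. \<xi> 0 (snd z) + (case z of (s, \<omega>) \<Rightarrow> M s \<omega>) + (case z of (s, \<omega>) \<Rightarrow> A s \<omega>)) \<in> borel_measurable ?N"
      by measurable
    also have "?this \<longleftrightarrow> (\<lambda>(s, \<omega>). \<xi> s \<omega>) \<in> borel_measurable ?N"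
    proof (rule measurable_cong)
      fix z assume "z \<in> space ?N"
      then obtain s \<omega> where "z = (s, \<omega>)" "s \<in> {0..T}" "\<omega> \<in> space P"
        using t subalgebra_F[OF t] by (auto simp: space_pair_measure subalgebra_def)
      then show "\<xi> 0 (snd z) + (case z of (s, \<omega>) \<Rightarrow> M s \<omega>) + (case z of (s, \<omega>) \<Rightarrow> A s \<omega>)
          = (case z of (s, \<omega>) \<Rightarrow> \<xi> s \<omega>)"
        using assms(12)[of s \<omega>] by simp
    qed
    finally show "(\<lambda>(s, \<omega>). \<xi> s \<omega>) \<in> borel_measurable ?N" .
  qed
  have modulus: "translation_modulus P T \<xi> h \<le> 2 * ennreal h * qv + 2 * ennreal h * tv"
    if h: "0 < h" "h \<le> T" for h
  proof -
    have "translation_modulus P T M h \<le> ennreal h * qv"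
      unfolding qv_def nn_integral_predictable_quadratic_variation[OF assms(4,6,7)]
      using assms(4,5) h by (rule translation_modulus_martingale_le)
    moreover have "translation_modulus P T A h \<le> ennreal h * tv"
    proof -
      have "translation_modulus P T A h
          \<le> (\<integral>\<^sup>+\<omega>. ennreal h * (total_variation T (\<lambda>t. A t \<omega>))\<^sup>2 \<partial>P)"
        unfolding translation_modulus_def power2_abs
        using assms(10) h
        by (intro nn_integral_mono nn_integral_translation_le_total_variation)
          (auto simp: finite_variation_process_def)
      also have "\<dots> \<le> ennreal h * tv"
        unfolding tv_def using h by (intro nn_integral_cmult_le)
      finally show ?thesis .
    qed
    moreover have "translation_modulus P T \<xi> h
        \<le> 2 * translation_modulus P T M h + 2 * translation_modulus P T A h"
    proof (rule translation_modulus_add_le[OF M_prog A_prog _ h(1)])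
      fix t s \<omega> assume "t \<in> {0..T}" "s \<in> {0..T}" "\<omega> \<in> space P"
      then show "\<xi> t \<omega> - \<xi> s \<omega> = (M t \<omega> - M s \<omega>) + (A t \<omega> - A s \<omega>)"
        using assms(12)[of t \<omega>] assms(12)[of s \<omega>] by linarith
    qed
    ultimately have "translation_modulus P T \<xi> h \<le> 2 * (ennreal h * qv) + 2 * (ennreal h * tv)"
      by (meson add_mono mult_left_mono order_trans zero_le)
    then show ?thesis
      by (simp add: mult.assoc)
  qed
  have modulus_K: "translation_modulus P T \<xi> h \<le> K * ennreal h" if h: "0 < h" for h
  proof -
    \<comment> \<open>The seminorm also ranges over \<open>h > T\<close>. There every lagged time is
      0, so the modulus keeps its value at \<open>T\<close>.\<close>
    have eq: "translation_modulus P T \<xi> h = translation_modulus P T \<xi> (min h T)"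
      unfolding translation_modulus_def using h
      by (intro nn_integral_cong) (auto simp: indicator_def max_def min_def)
    have "translation_modulus P T \<xi> h \<le> K * ennreal (min h T)"
      using modulus[of "min h T"] h T_pos
      unfolding eq K_def by (simp add: distrib_left distrib_right mult_ac)
    also have "\<dots> \<le> K * ennreal h"
      by (intro mult_left_mono ennreal_leI) auto
    finally show ?thesis .
  qed
  define C where "C = 2 * K + 2 * (\<integral>\<^sup>+\<omega>. ennreal ((\<xi> 0 \<omega> - x)\<^sup>2) \<partial>P)"
  \<comment> \<open>With the window \<open>sqrt \<kappa>\<close> both \<open>h\<close> and
    \<open>\<kappa> / h\<close> equal \<open>sqrt \<kappa>\<close>, hence the factor 2.\<close>
  have value_le: "value_function P F T x \<xi> \<kappa> \<le> ennreal (2 * sqrt \<kappa>) * C" if "0 < \<kappa>" for \<kappa>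
    using value_function_le[OF \<xi>_prog assms(3) modulus_K K_fin, of "sqrt \<kappa>" \<kappa> x] that
    by (simp add: C_def real_div_sqrt)
  have C_fin: "C < \<infinity>"
    using nn_integral_sq_diff_const_finite[OF measurable_F[OF assms(2)] assms(3), of x] K_fin T_pos
    by (simp add: C_def ennreal_mult_less_top)
  have fin: "ennreal (2 * sqrt \<kappa>) * C < \<infinity>" for \<kappa>
    using C_fin by (simp add: ennreal_mult_less_top)
  have "translation_seminorm_sq P T \<xi> \<le> K"
    unfolding translation_seminorm_sq_def
    using modulus_K by (intro SUP_least divide_le_posI_ennreal) (auto simp: mult.commute)
  then have "translation_seminorm_sq P T \<xi> < \<infinity>"
    using K_fin by (rule le_less_trans)
  \<comment> \<open>Since \<open>enn2real\<close> sends infinity to 0, the asymptotic bound alone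
    would not exclude infinite values; finiteness is therefore established separately.\<close>
  moreover have "\<forall>\<^sub>F \<kappa> in at_right 0. value_function P F T x \<xi> \<kappa> < \<infinity>"
    using eventually_at_right_less[of 0]
    by eventually_elim (use value_le fin in \<open>blast intro: le_less_trans\<close>)
  moreover have "(\<lambda>\<kappa>. enn2real (value_function P F T x \<xi> \<kappa>)) \<in> O[at_right 0](sqrt)"
  proof (rule bigoI)
    show "\<forall>\<^sub>F \<kappa> in at_right 0. norm (enn2real (value_function P F T x \<xi> \<kappa>))
        \<le> 2 * enn2real C * norm (sqrt \<kappa>)"
      using eventually_at_right_less[of 0]
    proof eventually_elim
      case (elim \<kappa>)
      have "enn2real (value_function P F T x \<xi> \<kappa>) \<le> enn2real (ennreal (2 * sqrt \<kappa>) * C)"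
        using value_le[OF elim] fin[of \<kappa>] by (intro enn2real_mono) auto
      then show ?case
        using elim by (simp add: enn2real_mult mult_ac)
    qed
  qed
  ultimately show ?thesis
    using modulus by (simp add: qv_def tv_def)
qed

end
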